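(* Let $\|\cdot\|$ denote either the max norm (for every dimension) or the Euclidean norm (for every dimension). For each of these two choices there is a constant $c > 0$, depending only on the choice of norm, such that for every integer $d \geq 1$, writing $L = \mathbb{R}^d$ with the norm $\|\cdot\|$, there exists an admissible set $V \in \mathcal{A}(L)$ with $\left\| \sum_{v \in V} v \right\| \geq c d$; consequently $r(\mathcal{F}(L)) \geq c d$.
   Context: Let $L$ be a finite-dimensional real normed space. A finite set of (distinct) vectors $\{v_1, \ldots, v_k\} \subset L$ is called admissible if $\|v_i\| \leq 1$ for all $i$ and $\| \varepsilon_1 v_1 + \ldots + \varepsilon_k v_k \| > 1$ for every sequence of coefficients $\varepsilon_i \in \{-1, 0, 1\}$ with at least two non-zero terms; the empty set is admissible. $\mathcal{A}(L)$ denotes the family of all admissible sets in $L$. For a finite set $\{v_1, \ldots, v_k\} \subset L$, $\Pi(\{v_1, \ldots, v_k\})$ denotes the set of all linear combinations $\pm v_1 \pm v_2 \pm \ldots \pm v_k$ over all sign patterns, with $\Pi(\varnothing) = \{\mathbf{0}\}$. Put $\mathcal{F}(L) = \{ \Pi(V) : V \in \mathcal{A}(L) \}$. For a family $\mathcal{F}$ of subsets of $L$, $r(\mathcal{F}) = \sup_{F \in \mathcal{F}} \sup_{v \in F} \|v\|$. *)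

theory Defs
  imports "HOL-Analysis.Analysis" "HOL-Analysis.Finite_Function_Topology"
begin

text \<open>
  A real normed space is given by a linear subspace \<open>L\<close> of an ambient real vector space together
  with a norm \<open>N\<close> on it. Passing \<open>L\<close> and \<open>N\<close> explicitly, rather than as a type of class
  \<open>real_normed_vector\<close>, allows quantification over the dimension inside a formula.
\<close>

definition admissible :: "'a::real_vector set \<Rightarrow> ('a \<Rightarrow> real) \<Rightarrow> 'a set \<Rightarrow> bool" where
  "admissible L N V \<longleftrightarrow>
     finite V \<and> V \<subseteq> L \<and> (\<forall>v\<in>V. N v \<le> 1) \<and>
     (\<forall>\<epsilon>. (\<forall>v\<in>V. \<epsilon> v \<in> {-1, 0, 1}) \<and> card {v \<in> V. \<epsilon> v \<noteq> 0} \<ge> 2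
            \<longrightarrow> N (\<Sum>v\<in>V. \<epsilon> v *\<^sub>R v) > 1)"

definition admissible_sets :: "'a::real_vector set \<Rightarrow> ('a \<Rightarrow> real) \<Rightarrow> 'a set set" where
  "admissible_sets L N = {V. admissible L N V}"

definition sign_sums :: "'a::real_vector set \<Rightarrow> 'a set" where
  "sign_sums V = {\<Sum>v\<in>V. \<epsilon> v *\<^sub>R v | \<epsilon>. \<forall>v\<in>V. \<epsilon> v \<in> {-1, 1}}"

definition sign_sum_family :: "'a::real_vector set \<Rightarrow> ('a \<Rightarrow> real) \<Rightarrow> 'a set set" where
  "sign_sum_family L N = sign_sums ` admissible_sets L N"

text \<open>The supremum is taken in the extended reals, so that no boundedness is presupposed.\<close>

definition family_radius :: "('a \<Rightarrow> real) \<Rightarrow> 'a set set \<Rightarrow> ereal" where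
  "family_radius N \<F> = (SUP F\<in>\<F>. SUP v\<in>F. ereal (N v))"

text \<open>
  The space of real \<open>d\<close>-tuples, as the finitely supported functions on the natural numbers that
  vanish outside \<open>{..<d}\<close>. The type \<^typ>\<open>nat \<Rightarrow>\<^sub>0 real\<close> is used only for its vector space
  structure: its type class norm is the sum norm and plays no role here.
\<close>

definition coord_space :: "nat \<Rightarrow> (nat \<Rightarrow>\<^sub>0 real) set" where
  "coord_space d = {x. Poly_Mapping.keys x \<subseteq> {..<d}}"

text \<open>Meaningful for \<open>d \<ge> 1\<close> only, since \<^term>\<open>Max {}\<close> is unspecified.\<close>

definition max_norm :: "nat \<Rightarrow> (nat \<Rightarrow>\<^sub>0 real) \<Rightarrow> real" where
  "max_norm d x = Max ((\<lambda>i. \<bar>Poly_Mapping.lookup x i\<bar>) ` {..<d})"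

definition euclidean_norm :: "nat \<Rightarrow> (nat \<Rightarrow>\<^sub>0 real) \<Rightarrow> real" where
  "euclidean_norm d x = L2_set (Poly_Mapping.lookup x) {..<d}"

lemma lookup_scaleR [simp]:
  fixes x :: "'b \<Rightarrow>\<^sub>0 'a::real_vector"
  shows "Poly_Mapping.lookup (c *\<^sub>R x) i = c *\<^sub>R Poly_Mapping.lookup x i"
proof -
  have "finite {i. c *\<^sub>R Poly_Mapping.lookup x i \<noteq> 0}"
    by (rule finite_subset[OF _ finite_lookup[of x]]) auto
  then show ?thesis
    by (simp add: scaleR_poly_mapping_def Abs_poly_mapping_inverse)
qed

lemma subspace_coord_space: "subspace (coord_space d)"
  by (auto simp: subspace_def coord_space_def in_keys_iff lookup_add subset_iff)
     (metis add_0)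

lemma sign_sums_empty: "sign_sums {} = {0}"
  by (simp add: sign_sums_def)

lemma admissible_empty: "admissible L N {}"
  by (simp add: admissible_def)

end

theory Submission
  imports Defs
begin

text \<open>
  In both cases the vectors of \<open>V\<close> share one positive first coordinate \<open>a\<close>, independent of \<open>d\<close>,
  so that \<open>\<Sum>v\<in>V. v\<close> has norm at least \<open>a * card V\<close> with \<open>card V\<close> linear in \<open>d\<close>. Orthogonality of
  suitable projections of these vectors makes the sum of squared coordinates of a signed sum grow
  with its number of terms, which keeps sums of at least two terms outside the unit ball.

  For the Euclidean norm, take \<open>v\<^sub>i = 3/5 e\<^sub>0 + 4/5 e\<^sub>i\<close> for \<open>1 \<le> i < d\<close> (and
  a single unit vector if \<open>d = 1\<close>). These are unit vectors, and
  projecting away \<open>e\<^sub>0\<close> shows that a signed sum with \<open>n \<ge> 2\<close> nonzero terms has squared norm at least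
  \<open>16/25 * n > 1\<close> (lemma \<open>euclidean_norm_signed_spike_sum\<close>).

  For the max norm, take the columns of the Sylvester-Hadamard matrix whose order is the largest
  power \<open>2^m \<le> d\<close>. Its entries are \<open>\<plusminus>1\<close>, its first row is constantly \<open>1\<close>, and it multiplies squared
  Euclidean norms by \<open>2^m\<close> (lemma \<open>walsh_energy\<close>). Hence the first \<open>2^m\<close> coordinates of a signed sum
  with \<open>n \<ge> 2\<close> nonzero terms have mean square \<open>n\<close>, so one of them is at least \<open>sqrt 2 > 1\<close> in absolute
  value. The first coordinate of the sum of all columns is \<open>2^m > d / 2\<close>.
\<close>

section \<open>Admissible sets from indexed families\<close>

text \<open>
  Distinctness of the vectors comes for free: if \<open>f i = f j\<close>, then the signed sum
  \<open>f i - f j = 0\<close> would have two nonzero coefficients.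
\<close>

lemma admissible_image:
  fixes f :: "'i \<Rightarrow> 'a::real_vector"
  assumes fin: "finite I" and L: "f ` I \<subseteq> L" and le: "\<And>i. i \<in> I \<Longrightarrow> N (f i) \<le> 1"
    and zero: "N 0 \<le> 1"
    and gt: "\<And>\<epsilon>. (\<And>i. i \<in> I \<Longrightarrow> \<epsilon> i \<in> {-1, 0, 1}) \<Longrightarrow> card {i \<in> I. \<epsilon> i \<noteq> 0} \<ge> 2
              \<Longrightarrow> N (\<Sum>i\<in>I. \<epsilon> i *\<^sub>R f i) > 1"
  shows "inj_on f I \<and> admissible L N (f ` I)"
proof -
  have inj: "inj_on f I"
  proof (rule inj_onI, rule ccontr)
    fix i j assume ij: "i \<in> I" "j \<in> I" "f i = f j" "i \<noteq> j"
    let ?\<epsilon> = "\<lambda>k. if k = i then 1 else if k = j then -1 else 0 :: real"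
    have "{k \<in> I. ?\<epsilon> k \<noteq> 0} = {i, j}"
      using ij by auto
    then have "N (\<Sum>k\<in>I. ?\<epsilon> k *\<^sub>R f k) > 1"
      using ij by (intro gt) auto
    also have "(\<Sum>k\<in>I. ?\<epsilon> k *\<^sub>R f k) = (\<Sum>k\<in>{i, j}. ?\<epsilon> k *\<^sub>R f k)"
      using ij fin by (intro sum.mono_neutral_right) auto
    also have "\<dots> = 0"
      using ij by simp
    finally show False
      using zero by simp
  qed
  have "admissible L N (f ` I)"
    unfolding admissible_def
  proof (intro conjI allI impI)
    fix \<epsilon> :: "'a \<Rightarrow> real"
    assume \<epsilon>: "(\<forall>v\<in>f ` I. \<epsilon> v \<in> {-1, 0, 1}) \<and> 2 \<le> card {v \<in> f ` I. \<epsilon> v \<noteq> 0}"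
    have "{v \<in> f ` I. \<epsilon> v \<noteq> 0} = f ` {i \<in> I. \<epsilon> (f i) \<noteq> 0}"
      by auto
    then have "card {v \<in> f ` I. \<epsilon> v \<noteq> 0} = card {i \<in> I. \<epsilon> (f i) \<noteq> 0}"
      using inj by (simp add: card_image inj_on_def)
    then have "N (\<Sum>i\<in>I. \<epsilon> (f i) *\<^sub>R f i) > 1"
      using \<epsilon> by (intro gt) auto
    then show "N (\<Sum>v\<in>f ` I. \<epsilon> v *\<^sub>R v) > 1"
      by (simp add: sum.reindex[OF inj])
  qed (use fin L le in auto)
  with inj show ?thesis ..
qed

lemma sum_squares_signs:
  fixes \<epsilon> :: "'i \<Rightarrow> real"
  assumes "finite I" and "\<And>i. i \<in> I \<Longrightarrow> \<epsilon> i \<in> {-1, 0, 1}"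
  shows "(\<Sum>i\<in>I. (\<epsilon> i)\<^sup>2) = real (card {i \<in> I. \<epsilon> i \<noteq> 0})"
proof -
  have "(\<Sum>i\<in>I. (\<epsilon> i)\<^sup>2) = (\<Sum>i\<in>I. if \<epsilon> i \<noteq> 0 then 1 else 0)"
    using assms(2) by (intro sum.cong) fastforce+
  also have "\<dots> = real (card {i \<in> I. \<epsilon> i \<noteq> 0})"
    using assms(1) by (simp add: sum.If_cases Int_def)
  finally show ?thesis .
qed

lemma family_radius_ge_sum:
  assumes "V \<in> admissible_sets L N"
  shows "family_radius N (sign_sum_family L N) \<ge> ereal (N (\<Sum>v\<in>V. v))"
proof -
  have "(\<Sum>v\<in>V. v) \<in> sign_sums V"
    unfolding sign_sums_def by (intro CollectI exI[of _ "\<lambda>_. 1"]) simp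
  then have "ereal (N (\<Sum>v\<in>V. v)) \<le> (SUP v\<in>sign_sums V. ereal (N v))"
    by (rule SUP_upper)
  also have "\<dots> \<le> family_radius N (sign_sum_family L N)"
    unfolding family_radius_def sign_sum_family_def using assms by (intro SUP_upper) auto
  finally show ?thesis .
qed

section \<open>Coordinate vectors and their norms\<close>

definition coord_vec :: "nat \<Rightarrow> (nat \<Rightarrow> real) \<Rightarrow> (nat \<Rightarrow>\<^sub>0 real)" where
  "coord_vec d g = Abs_poly_mapping (\<lambda>i. if i < d then g i else 0)"

lemma lookup_coord_vec [simp]:
  "Poly_Mapping.lookup (coord_vec d g) i = (if i < d then g i else 0)"
proof -
  have "finite {i. (if i < d then g i else 0) \<noteq> 0}"
    by (rule finite_subset[of _ "{..<d}"]) auto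
  then show ?thesis
    by (simp add: coord_vec_def Abs_poly_mapping_inverse)
qed

lemma coord_vec_in_coord_space: "coord_vec d g \<in> coord_space d"
  by (auto simp: coord_space_def in_keys_iff split: if_splits)

lemma abs_lookup_le_max_norm:
  assumes "i < d"
  shows "\<bar>Poly_Mapping.lookup x i\<bar> \<le> max_norm d x"
  unfolding max_norm_def using assms by (intro Max_ge) auto

lemma max_norm_le:
  assumes "d \<ge> 1" and "\<And>i. i < d \<Longrightarrow> \<bar>Poly_Mapping.lookup x i\<bar> \<le> b"
  shows "max_norm d x \<le> b"
proof -
  have "{..<d} \<noteq> {}"
    using assms(1) by (simp add: lessThan_empty_iff)
  then show ?thesis
    unfolding max_norm_def using assms(2) by (subst Max_le_iff) auto
qed

lemma euclidean_norm_power2: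
  "(euclidean_norm d x)\<^sup>2 = (\<Sum>i<d. (Poly_Mapping.lookup x i)\<^sup>2)"
  by (simp add: euclidean_norm_def L2_set_def sum_nonneg)

lemma abs_lookup_le_euclidean_norm:
  assumes "i < d"
  shows "\<bar>Poly_Mapping.lookup x i\<bar> \<le> euclidean_norm d x"
proof -
  have "(Poly_Mapping.lookup x i)\<^sup>2 \<le> (euclidean_norm d x)\<^sup>2"
    unfolding euclidean_norm_power2 using assms
    by (intro member_le_sum[of i "{..<d}" "\<lambda>i. (Poly_Mapping.lookup x i)\<^sup>2"]) auto
  then show ?thesis
    by (simp add: euclidean_norm_def flip: abs_le_square_iff)
qed

section \<open>Max norm: columns of a Hadamard matrix\<close>

text \<open>
  The entry \<open>(-1)^b\<close> of the Sylvester-Hadamard matrix of order \<open>2^m\<close>, where \<open>b\<close> counts the common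
  binary digits \<open>1\<close> of \<open>i\<close> and \<open>j\<close> among the lowest \<open>m\<close> places. Row indices beyond \<open>2^m\<close> repeat
  earlier rows, so \<open>walsh m i j\<close> is a sign for every \<open>i\<close>, and the rows \<open>i < d\<close> can be used
  also when \<open>d\<close> is not a power of two.
\<close>

fun walsh :: "nat \<Rightarrow> nat \<Rightarrow> nat \<Rightarrow> real" where
  "walsh 0 i j = 1"
| "walsh (Suc m) i j = (if odd i \<and> odd j then -1 else 1) * walsh m (i div 2) (j div 2)"

lemma abs_walsh: "\<bar>walsh m i j\<bar> = 1"
  by (induction m arbitrary: i j) (auto simp: abs_mult)

lemma walsh_first_row: "walsh m 0 j = 1"
  by (induction m arbitrary: j) auto

text \<open>
  Splitting \<open>x\<close> by the parity of its index, rows \<open>2 i\<close> and \<open>2 i + 1\<close> yield \<open>A i + B i\<close> and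
  \<open>A i - B i\<close>, where \<open>A\<close> and \<open>B\<close> are the transforms of order \<open>2^m\<close> of the two halves; then apply the
  parallelogram identity.
\<close>

lemma walsh_energy:
  "(\<Sum>i<2^m. (\<Sum>j<2^m. x j * walsh m i j)\<^sup>2) = 2^m * (\<Sum>j<2^m. (x j)\<^sup>2)"
proof (induction m arbitrary: x)
  case 0
  then show ?case by simp
next
  case (Suc m)
  have split: "(\<Sum>i<2 ^ Suc m. h i) = (\<Sum>i<2^m. h (2 * i)) + (\<Sum>i<2^m. h (2 * i + 1))"
    for h :: "nat \<Rightarrow> real"
    using sum_split_even_odd[of h h "2^m"] by simp
  define A where "A i = (\<Sum>j<2^m. x (2 * j) * walsh m i j)" for i
  define B where "B i = (\<Sum>j<2^m. x (2 * j + 1) * walsh m i j)" for i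
  have even_row: "(\<Sum>j<2 ^ Suc m. x j * walsh (Suc m) (2 * i) j) = A i + B i" for i
    unfolding split by (simp add: A_def B_def)
  have odd_row: "(\<Sum>j<2 ^ Suc m. x j * walsh (Suc m) (2 * i + 1) j) = A i - B i" for i
    unfolding split by (simp add: A_def B_def sum_negf)
  have "(\<Sum>i<2 ^ Suc m. (\<Sum>j<2 ^ Suc m. x j * walsh (Suc m) i j)\<^sup>2)
          = (\<Sum>i<2^m. (A i + B i)\<^sup>2) + (\<Sum>i<2^m. (A i - B i)\<^sup>2)"
    by (subst split) (simp only: even_row odd_row)
  also have "\<dots> = 2 * ((\<Sum>i<2^m. (A i)\<^sup>2) + (\<Sum>i<2^m. (B i)\<^sup>2))"
    by (simp add: power2_sum power2_diff sum.distrib sum_subtractf)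
  also have "(\<Sum>i<2^m. (A i)\<^sup>2) = 2^m * (\<Sum>j<2^m. (x (2 * j))\<^sup>2)"
    unfolding A_def by (rule Suc.IH)
  also have "(\<Sum>i<2^m. (B i)\<^sup>2) = 2^m * (\<Sum>j<2^m. (x (2 * j + 1))\<^sup>2)"
    unfolding B_def by (rule Suc.IH)
  also have "2 * (2^m * (\<Sum>j<2^m. (x (2 * j))\<^sup>2) + 2^m * (\<Sum>j<2^m. (x (2 * j + 1))\<^sup>2))
      = 2 ^ Suc m * (\<Sum>j<2 ^ Suc m. (x j)\<^sup>2)"
    unfolding split by (simp add: algebra_simps)
  finally show ?case .
qed

text \<open>By \<open>walsh_energy\<close>, the squared coordinates average to the number of nonzero coefficients.\<close>

lemma walsh_signed_sum_large:
  assumes \<epsilon>: "\<And>j. j < 2^m \<Longrightarrow> \<epsilon> j \<in> {-1, 0, 1}" and card: "card {j \<in> {..<2^m}. \<epsilon> j \<noteq> 0} \<ge> 2"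
  shows "\<exists>i<2^m. \<bar>\<Sum>j<2^m. \<epsilon> j * walsh m i j\<bar> > 1"
proof (rule ccontr)
  assume "\<not> ?thesis"
  then have "\<bar>\<Sum>j<2^m. \<epsilon> j * walsh m i j\<bar> \<le> 1" if "i < 2^m" for i
    using that by (meson not_less)
  then have "(\<Sum>i<2^m. (\<Sum>j<2^m. \<epsilon> j * walsh m i j)\<^sup>2) \<le> (\<Sum>i<(2::nat)^m. 1)"
    by (intro sum_mono) (simp add: abs_square_le_1)
  then have "2^m * (\<Sum>j<2^m. (\<epsilon> j)\<^sup>2) \<le> (2::real)^m"
    by (simp add: walsh_energy)
  moreover have "(\<Sum>j<2^m. (\<epsilon> j)\<^sup>2) \<ge> 2"
    using card \<epsilon> by (subst sum_squares_signs) auto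
  ultimately show False
    by simp
qed

lemma max_norm_large_admissible:
  assumes d: "d \<ge> 1"
  shows "\<exists>V \<in> admissible_sets (coord_space d) (max_norm d). max_norm d (\<Sum>v\<in>V. v) \<ge> 1/2 * real d"
proof -
  obtain m where m: "2^m \<le> d" "d < 2 ^ Suc m"
    using ex_power_ivl1[of 2 d] d by auto
  define f where "f j = coord_vec d (\<lambda>i. walsh m i j)" for j
  define I :: "nat set" where "I = {..<2^m}"
  have adm: "inj_on f I \<and> admissible (coord_space d) (max_norm d) (f ` I)"
  proof (rule admissible_image)
    fix \<epsilon> :: "nat \<Rightarrow> real"
    assume "\<And>i. i \<in> I \<Longrightarrow> \<epsilon> i \<in> {-1, 0, 1}" "2 \<le> card {i \<in> I. \<epsilon> i \<noteq> 0}"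
    then obtain i where i: "i < 2^m" "\<bar>\<Sum>j<2^m. \<epsilon> j * walsh m i j\<bar> > 1"
      unfolding I_def using walsh_signed_sum_large[of m \<epsilon>] by auto
    have "i < d"
      using i m by linarith
    then have "Poly_Mapping.lookup (\<Sum>j\<in>I. \<epsilon> j *\<^sub>R f j) i = (\<Sum>j<2^m. \<epsilon> j * walsh m i j)"
      by (simp add: lookup_sum f_def I_def)
    then show "max_norm d (\<Sum>j\<in>I. \<epsilon> j *\<^sub>R f j) > 1"
      using abs_lookup_le_max_norm[OF \<open>i < d\<close>, of "\<Sum>j\<in>I. \<epsilon> j *\<^sub>R f j"] i(2) by simp
  qed (use d in \<open>auto simp: I_def f_def coord_vec_in_coord_space abs_walsh intro!: max_norm_le\<close>)
  have "1/2 * real d \<le> 2^m"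
    using m(2) by (simp flip: of_nat_less_iff[where ?'a = real])
  also have "\<dots> = Poly_Mapping.lookup (\<Sum>j\<in>I. f j) 0"
    using d by (simp add: lookup_sum f_def I_def walsh_first_row)
  also have "\<dots> \<le> max_norm d (\<Sum>j\<in>I. f j)"
    using abs_lookup_le_max_norm[of 0 d "\<Sum>j\<in>I. f j"] d by simp
  also have "(\<Sum>j\<in>I. f j) = (\<Sum>v\<in>f ` I. v)"
    using sum.reindex[OF conjunct1[OF adm], of "\<lambda>v. v"] by (simp add: comp_def)
  finally show ?thesis
    using adm by (auto simp: admissible_sets_def)
qed

section \<open>Euclidean norm: orthonormal vectors tilted towards a common axis\<close>

definition spike :: "nat \<Rightarrow> nat \<Rightarrow> (nat \<Rightarrow>\<^sub>0 real)" where
  "spike d j = coord_vec d (\<lambda>i. if i = 0 then 3/5 else if i = j then 4/5 else 0)"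

lemma euclidean_norm_spike:
  assumes "j \<in> {1..<d}"
  shows "euclidean_norm d (spike d j) \<le> 1"
proof -
  have "(euclidean_norm d (spike d j))\<^sup>2
          = (\<Sum>i<d. (if i = 0 then 3/5 else if i = j then 4/5 else 0)\<^sup>2)"
    unfolding euclidean_norm_power2 by (intro sum.cong) (auto simp: spike_def)
  also have "\<dots> = (\<Sum>i\<in>{0, j}. (if i = 0 then 3/5 else if i = j then 4/5 else 0)\<^sup>2)"
    using assms by (intro sum.mono_neutral_right) auto
  also have "\<dots> = 1"
    using assms by (simp add: power2_eq_square)
  finally show ?thesis
    by (auto simp: power2_eq_1_iff)
qed

text \<open>
  Only the coordinates other than \<open>0\<close> are counted; they equal \<open>4/5\<close> times the coefficients, and
  \<open>2 * (4/5)^2 > 1\<close>.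
\<close>

lemma euclidean_norm_signed_spike_sum:
  assumes \<epsilon>: "\<And>j. j \<in> {1..<d} \<Longrightarrow> \<epsilon> j \<in> {-1, 0, 1}" and card: "card {j \<in> {1..<d}. \<epsilon> j \<noteq> 0} \<ge> 2"
  shows "euclidean_norm d (\<Sum>j\<in>{1..<d}. \<epsilon> j *\<^sub>R spike d j) > 1"
proof -
  let ?x = "\<Sum>j\<in>{1..<d}. \<epsilon> j *\<^sub>R spike d j"
  have lookup: "Poly_Mapping.lookup ?x i = 4/5 * \<epsilon> i" if "i \<in> {1..<d}" for i
  proof -
    have "Poly_Mapping.lookup ?x i = (\<Sum>j\<in>{1..<d}. if i = j then 4/5 * \<epsilon> j else 0)"
      unfolding lookup_sum using that by (intro sum.cong) (auto simp: spike_def)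
    then show ?thesis
      using that by simp
  qed
  have "1 < 16/25 * real (card {j \<in> {1..<d}. \<epsilon> j \<noteq> 0})"
    using card by linarith
  also have "\<dots> = 16/25 * (\<Sum>i\<in>{1..<d}. (\<epsilon> i)\<^sup>2)"
    using \<epsilon> by (subst sum_squares_signs) auto
  also have "\<dots> = (\<Sum>i\<in>{1..<d}. (Poly_Mapping.lookup ?x i)\<^sup>2)"
    unfolding sum_distrib_left
    by (intro sum.cong) (simp_all only: lookup, simp_all add: power2_eq_square)
  also have "\<dots> \<le> (euclidean_norm d ?x)\<^sup>2"
    unfolding euclidean_norm_power2 by (intro sum_mono2) auto
  finally have "1\<^sup>2 < (euclidean_norm d ?x)\<^sup>2"
    by simp
  then show ?thesis
    by (rule power2_less_imp_less) (simp add: euclidean_norm_def)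
qed

lemma euclidean_norm_large_admissible:
  assumes d: "d \<ge> 1"
  shows "\<exists>V \<in> admissible_sets (coord_space d) (euclidean_norm d).
           euclidean_norm d (\<Sum>v\<in>V. v) \<ge> 3/10 * real d"
proof (cases "d = 1")
  case True
  \<comment> \<open>No axis is left for a spike here, and a single unit vector suffices.\<close>
  let ?e = "coord_vec 1 (\<lambda>_. 1)"
  have norm: "euclidean_norm 1 ?e = 1"
    by (simp add: euclidean_norm_def L2_set_def)
  have "inj_on (\<lambda>_. ?e) {()} \<and>
      admissible (coord_space 1) (euclidean_norm 1) ((\<lambda>_. ?e) ` {()})"
  proof (rule admissible_image)
    fix \<epsilon> :: "unit \<Rightarrow> real"
    assume "2 \<le> card {i \<in> {()}. \<epsilon> i \<noteq> 0}"
    moreover have "card {i \<in> {()}. \<epsilon> i \<noteq> 0} \<le> card {()}"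
      by (intro card_mono) auto
    ultimately show "euclidean_norm 1 (\<Sum>i\<in>{()}. \<epsilon> i *\<^sub>R ?e) > 1"
      by simp
  qed (use norm in \<open>auto simp: coord_vec_in_coord_space euclidean_norm_def L2_set_def\<close>)
  then show ?thesis
    using norm True by (intro bexI[of _ "{?e}"]) (auto simp: admissible_sets_def)
next
  case False
  let ?I = "{1..<d}"
  have adm: "inj_on (spike d) ?I \<and> admissible (coord_space d) (euclidean_norm d) (spike d ` ?I)"
  proof (rule admissible_image)
    fix \<epsilon> :: "nat \<Rightarrow> real"
    assume "\<And>i. i \<in> ?I \<Longrightarrow> \<epsilon> i \<in> {-1, 0, 1}" "2 \<le> card {i \<in> ?I. \<epsilon> i \<noteq> 0}"
    then show "euclidean_norm d (\<Sum>j\<in>?I. \<epsilon> j *\<^sub>R spike d j) > 1"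
      by (rule euclidean_norm_signed_spike_sum)
  next
    show "spike d ` ?I \<subseteq> coord_space d"
      by (auto simp: spike_def coord_vec_in_coord_space)
  qed (auto simp: euclidean_norm_spike, simp_all add: euclidean_norm_def L2_set_def)
  have "3/10 * real d \<le> 3/5 * real (d - 1)"
    using d False by (simp add: of_nat_diff)
  also have "\<dots> = Poly_Mapping.lookup (\<Sum>j\<in>?I. spike d j) 0"
    using d by (simp add: lookup_sum spike_def)
  also have "\<dots> \<le> euclidean_norm d (\<Sum>j\<in>?I. spike d j)"
    using abs_lookup_le_euclidean_norm[of 0 d "\<Sum>j\<in>?I. spike d j"] d by simp
  also have "(\<Sum>j\<in>?I. spike d j) = (\<Sum>v\<in>spike d ` ?I. v)"
    using sum.reindex[OF conjunct1[OF adm], of "\<lambda>v. v"] by (simp add: comp_def)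
  finally show ?thesis
    using adm by (auto simp: admissible_sets_def)
qed

section \<open>Linear growth for both norms\<close>

theorem mainTheorem3:
  fixes N :: "nat \<Rightarrow> (nat \<Rightarrow>\<^sub>0 real) \<Rightarrow> real"
  assumes "N = max_norm \<or> N = euclidean_norm"
  shows "\<exists>c::real. c > 0 \<and>
           (\<forall>d\<ge>1.
              (\<exists>V \<in> admissible_sets (coord_space d) (N d). N d (\<Sum>v\<in>V. v) \<ge> c * real d) \<and>
              family_radius (N d) (sign_sum_family (coord_space d) (N d)) \<ge> ereal (c * real d))"
proof -
  obtain c where "c > 0" and ex: "\<And>d. d \<ge> 1 \<Longrightarrow>
      \<exists>V \<in> admissible_sets (coord_space d) (N d). N d (\<Sum>v\<in>V. v) \<ge> c * real d"
  proof (rule disjE[OF assms])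
    assume "N = max_norm"
    then show thesis
      using that[of "1/2"] max_norm_large_admissible by simp
  next
    assume "N = euclidean_norm"
    then show thesis
      using that[of "3/10"] euclidean_norm_large_admissible by simp
  qed
  have "family_radius (N d) (sign_sum_family (coord_space d) (N d)) \<ge> ereal (c * real d)"
    if d: "d \<ge> 1" for d
  proof -
    obtain V where V: "V \<in> admissible_sets (coord_space d) (N d)"
      and le: "c * real d \<le> N d (\<Sum>v\<in>V. v)"
      using ex[OF d] by blast
    from le have "ereal (c * real d) \<le> ereal (N d (\<Sum>v\<in>V. v))"
      by simp
    also have "\<dots> \<le> family_radius (N d) (sign_sum_family (coord_space d) (N d))"
      by (rule family_radius_ge_sum[OF V])
    finally show ?thesis .
  qed
  then show ?thesis
    using \<open>c > 0\<close> ex by blast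
qed

end
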